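(* Let $(v,k,\lambda,\mu)$ be the parameters of a primitive strongly regular graph with $v\leq 30$. (1) If $(v,k,\lambda,\mu)\notin\{(15,8,4,4),(21,10,5,4),(28,12,6,4)\}$, then every primitive $(v,k,\lambda,\mu)$-SRG $G$ satisfies Brouwer's Conjecture: if $S$ is a disconnecting set of $G$ such that every component of $G\setminus S$ has at least two vertices, then $|S|\geq 2k-\lambda-2$. (2) If $(v,k,\lambda,\mu)\in\{(15,8,4,4),(21,10,5,4),(28,12,6,4)\}$, then there is at least one $(v,k,\lambda,\mu)$-SRG $G$ that is a counterexample to Brouwer's Conjecture: $G$ has a disconnecting set $S$ such that every component of $G\setminus S$ has at least two vertices and $|S|<2k-\lambda-2$.
   Context: All graphs are finite and simple. A graph $G$ is a $(v,k,\lambda,\mu)$-SRG (strongly regular graph) if it has $v$ vertices, is $k$-regular, any two adjacent vertices have exactly $\lambda$ common neighbors, and any two distinct non-adjacent vertices have exactly $\mu$ common neighbors. A strongly regular graph (neither complete nor edgeless) is primitive if both it and its complement are connected. A disconnecting set of a connected graph $G$ is a set $S$ of vertices such that $G\setminus S$ is disconnected. *)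

theory Defs
  imports "Graph_Theory.Digraph_Component" "Graph_Theory.Kuratowski"
begin

text \<open>
  Finite simple graphs are the \<open>pair_graph\<close>s of the Graph Theory library: a finite vertex set
  together with a symmetric, irreflexive set of ordered pairs. The coercion \<open>with_proj\<close> turns such
  a graph into a \<open>pre_digraph\<close>. The library's \<open>connected\<close> fails for the graph without vertices.
\<close>

definition neighbors :: "'a pair_pre_digraph \<Rightarrow> 'a \<Rightarrow> 'a set" where
  "neighbors G u = {w \<in> pverts G. (u, w) \<in> parcs G}"

definition complement_graph :: "'a pair_pre_digraph \<Rightarrow> 'a pair_pre_digraph" where
  "complement_graph G =
    \<lparr> pverts = pverts G,
      parcs = {(u, w). u \<in> pverts G \<and> w \<in> pverts G \<and> u \<noteq> w \<and> (u, w) \<notin> parcs G} \<rparr>"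

definition srg :: "nat \<Rightarrow> nat \<Rightarrow> nat \<Rightarrow> nat \<Rightarrow> 'a pair_pre_digraph \<Rightarrow> bool" where
  "srg v k lam mu G \<longleftrightarrow>
    pair_graph G \<and>
    card (pverts G) = v \<and>
    (\<forall>u \<in> pverts G. card (neighbors G u) = k) \<and>
    (\<forall>u \<in> pverts G. \<forall>w \<in> pverts G. (u, w) \<in> parcs G \<longrightarrow>
       card (neighbors G u \<inter> neighbors G w) = lam) \<and>
    (\<forall>u \<in> pverts G. \<forall>w \<in> pverts G. u \<noteq> w \<and> (u, w) \<notin> parcs G \<longrightarrow>
       card (neighbors G u \<inter> neighbors G w) = mu)"

text \<open>
  Excluding complete and edgeless graphs matters only for the one-vertex graph, which is connected
  with connected complement and satisfies \<open>srg 1 0 lam mu\<close> for all \<open>lam\<close> and \<open>mu\<close>.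
\<close>

definition primitive_srg :: "nat \<Rightarrow> nat \<Rightarrow> nat \<Rightarrow> nat \<Rightarrow> 'a pair_pre_digraph \<Rightarrow> bool" where
  "primitive_srg v k lam mu G \<longleftrightarrow>
    srg v k lam mu G \<and>
    \<not> complete_digraph v (with_proj G) \<and> parcs G \<noteq> {} \<and>
    connected (with_proj G) \<and> connected (with_proj (complement_graph G))"

definition delete_verts ::
    "'a pair_pre_digraph \<Rightarrow> 'a set \<Rightarrow> ('a, 'a \<times> 'a) pre_digraph" where
  "delete_verts G S = with_proj G \<restriction> (pverts G - S)"

definition components :: "('a, 'b) pre_digraph \<Rightarrow> ('a, 'b) pre_digraph set" where
  "components H = {C. pre_digraph.max_subgraph H connected C}"

text \<open>
  The graph without vertices has no components and is not counted as disconnected, so \<open>S\<close> has to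
  leave at least one vertex.
\<close>

definition disconnecting_set :: "'a pair_pre_digraph \<Rightarrow> 'a set \<Rightarrow> bool" where
  "disconnecting_set G S \<longleftrightarrow>
    connected (with_proj G) \<and> S \<subseteq> pverts G \<and> pverts G - S \<noteq> {} \<and>
    \<not> connected (delete_verts G S)"

end

theory Submission
  imports "Jordan_Normal_Form.Schur_Decomposition" Defs
begin

text \<open>
  Let \<open>S\<close> separate \<open>A\<close> from \<open>B\<close>, with no isolated vertex outside \<open>S\<close>, and suppose \<open>|S| < 2k - \<lambda> - 2\<close>. An edge
  \<open>xy\<close> has \<open>|N(x) \<union> N(y)| = 2k - \<lambda>\<close>, so no edge can be a component and the inner degree sum \<open>d\<close> of a part of
  size \<open>a\<close> is at least \<open>a + 1\<close>. Let \<open>\<alpha>\<close> and \<open>\<beta>\<close> count the neighbours of a vertex of \<open>S\<close> in \<open>A\<close> and in \<open>B\<close>.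
  Strong regularity determines \<open>\<Sum>\<alpha> = k a - d\<close> and \<open>\<Sum>\<alpha> \<beta> = \<mu> |A| |B|\<close> over \<open>S\<close>, and also
  \<open>\<Sum>\<alpha>\<^sup>2 = k a + \<mu> a (a - 1) + (\<lambda> - \<mu>) d - q\<close> with \<open>q\<close> the sum of the squared inner degrees of \<open>A\<close>.
  Since all these counts are integers, the sums of squares have sharp lower bounds, and Cauchy--Schwarz
  bounds the covariance of \<open>\<alpha>\<close> and \<open>\<beta>\<close>. Together with \<open>k (k - 1 - \<lambda>) = (v - k - 1) \<mu>\<close> and the integrality of
  the eigenvalue multiplicities, this leaves only the parameters of \<open>T(6)\<close>, \<open>T(7)\<close>, \<open>T(8)\<close> for \<open>v \<le> 30\<close>.
  In the triangular graph \<open>T(n)\<close> the neighbours of a triangle \<open>{12, 13, 23}\<close> form a disconnecting set of size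
  \<open>3 (n - 3)\<close>, one less than the conjectured bound.
\<close>

section \<open>Connectivity as absence of cuts\<close>

text \<open>A vertex set that no arc leaves or enters contains everything reachable from its
  members, and the set reachable from \<open>u\<close> is itself such a set. Later arguments use
  cuts in place of paths.\<close>

lemma connected_iff_cut:
  assumes "wf_digraph H"
  shows "connected H \<longleftrightarrow> verts H \<noteq> {} \<and>
    (\<forall>X. X \<subseteq> verts H \<and> X \<noteq> {} \<and> (\<forall>(x, y) \<in> arcs_ends H. x \<in> X \<longleftrightarrow> y \<in> X) \<longrightarrow> X = verts H)"
    (is "_ \<longleftrightarrow> _ \<and> ?cut")
proof
  assume conn: "connected H"
  have "X = verts H"
    if X: "X \<subseteq> verts H" "X \<noteq> {}" "\<forall>(x, y) \<in> arcs_ends H. x \<in> X \<longleftrightarrow> y \<in> X" for X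
  proof -
    obtain u where u: "u \<in> X"
      using X by blast
    have "w \<in> X" if "w \<in> verts H" for w
    proof -
      have "(u, w) \<in> rtrancl_on (verts H) ((arcs_ends H)\<^sup>s)"
        using conn u X that by (auto simp: connected_conv)
      then show ?thesis
        using u X by (induct rule: rtrancl_on_induct) (auto simp: symcl_def)
    qed
    with X show ?thesis by blast
  qed
  with conn show "verts H \<noteq> {} \<and> ?cut"
    by (auto simp: connected_conv)
next
  assume cut: "verts H \<noteq> {} \<and> ?cut"
  interpret wf_digraph H by fact
  have "(u, w) \<in> rtrancl_on (verts H) ((arcs_ends H)\<^sup>s)" if uw: "u \<in> verts H" "w \<in> verts H" for u w
  proof -
    let ?R = "rtrancl_on (verts H) ((arcs_ends H)\<^sup>s)"
    let ?X = "{w. (u, w) \<in> ?R}"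
    have "?X \<subseteq> verts H"
      by (auto dest: in_rtrancl_on_in_F)
    moreover have "?X \<noteq> {}"
      using uw by blast
    moreover have "\<forall>(x, y) \<in> arcs_ends H. x \<in> ?X \<longleftrightarrow> y \<in> ?X"
      by (auto simp: symcl_def intro: rtrancl_on_into_rtrancl_on dest: adj_in_verts)
    ultimately have "?X = verts H"
      using cut by blast
    with uw show ?thesis by blast
  qed
  with cut show "connected H"
    by (auto simp: connected_conv)
qed

lemma delete_verts_simps:
  "verts (delete_verts G S) = pverts G - S"
  "arcs (delete_verts G S) = {(x, y) \<in> parcs G. x \<in> pverts G - S \<and> y \<in> pverts G - S}"
  "arcs_ends (delete_verts G S) = {(x, y) \<in> parcs G. x \<in> pverts G - S \<and> y \<in> pverts G - S}"
  "tail (delete_verts G S) = fst"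
  "head (delete_verts G S) = snd"
  by (auto simp: delete_verts_def induce_subgraph_def arcs_ends_conv)

lemma wf_delete_verts: "wf_digraph (delete_verts G S)"
  by unfold_locales (auto simp: delete_verts_simps)

lemma no_isolated_vertex_if_components:
  assumes comps: "\<forall>C \<in> components (delete_verts G S). card (verts C) \<ge> 2"
    and sym: "sym (parcs G)"
    and x: "x \<in> pverts G - S"
  shows "\<exists>y \<in> pverts G - S. (x, y) \<in> parcs G"
proof (rule ccontr)
  assume isolated: "\<not> ?thesis"
  let ?H = "delete_verts G S"
  let ?C = "\<lparr> verts = {x}, arcs = {}, tail = fst, head = snd \<rparr>"
  have no_arc: "fst e \<noteq> x" "snd e \<noteq> x" if "e \<in> arcs ?H" for e
    using that isolated sym by (auto simp: delete_verts_simps dest: symD)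
  have wfC: "wf_digraph ?C"
    by unfold_locales auto
  then have sub: "subgraph ?C ?H"
    using x wf_delete_verts[of G S] by (auto simp: subgraph_def compatible_def delete_verts_simps)
  have conn: "connected ?C"
    by (simp add: connected_conv)
  \<comment> \<open>Maximality: \<open>{x}\<close> is closed under adjacency, so a connected
    \<open>H'\<close> around it has no further vertex.\<close>
  have "H' = ?C" if sub': "subgraph ?C H'" "subgraph H' ?H" and conn': "connected H'" for H'
  proof -
    have H': "tail H' = fst" "head H' = snd" "arcs H' \<subseteq> arcs ?H" "x \<in> verts H'" "wf_digraph H'"
      using sub' by (auto simp: subgraph_def compatible_def delete_verts_simps)
    have "\<forall>(y, z) \<in> arcs_ends H'. y \<in> {x} \<longleftrightarrow> z \<in> {x}"
      using H' no_arc by (force simp: arcs_ends_conv)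
    then have "verts H' = {x}"
      using connected_iff_cut[OF H'(5)] conn' H'(4) by blast
    moreover from this have "arcs H' = {}"
      using H'(1,3) no_arc(1) wf_digraph.tail_in_verts[OF H'(5)] by (metis all_not_in_conv singletonD subsetD)
    ultimately show ?thesis
      using H' by (simp add: pre_digraph.equality)
  qed
  then have "?C \<in> components ?H"
    using sub conn by (auto simp: components_def pre_digraph.max_subgraph_def)
  with comps have "card (verts ?C) \<ge> 2"
    by blast
  then show False
    by simp
qed

text \<open>A one-vertex component could be enlarged by an edge at its vertex, against
  maximality.\<close>

lemma components_if_no_isolated_vertex:
  assumes loopfree: "\<And>y. (y, y) \<notin> parcs G"
    and sym: "sym (parcs G)"
    and fin: "finite (pverts G)"
    and nbr: "\<forall>x \<in> pverts G - S. \<exists>y \<in> pverts G - S. (x, y) \<in> parcs G"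
    and C: "C \<in> components (delete_verts G S)"
  shows "card (verts C) \<ge> 2"
proof (rule ccontr)
  assume small: "\<not> ?thesis"
  let ?H = "delete_verts G S"
  have sub: "subgraph C ?H" and conn: "connected C"
    and max: "\<And>H'. H' \<noteq> C \<Longrightarrow> subgraph C H' \<Longrightarrow> subgraph H' ?H \<Longrightarrow> \<not> connected H'"
    using C by (auto simp: components_def pre_digraph.max_subgraph_def)
  have C': "verts C \<subseteq> pverts G - S" "arcs C \<subseteq> parcs G" "tail C = fst" "head C = snd" "wf_digraph C"
    using sub by (auto simp: subgraph_def compatible_def delete_verts_simps)
  have "verts C \<noteq> {}"
    using conn by (simp add: connected_conv)
  moreover have "finite (verts C)"
    using C'(1) fin finite_subset by blast
  ultimately have "card (verts C) = 1"
    using small by (simp add: Suc_leI card_gt_0_iff le_antisym not_le less_Suc_eq_le numeral_2_eq_2)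
  then obtain x where x: "verts C = {x}"
    by (auto simp: card_1_singleton_iff)
  obtain y where y: "y \<in> pverts G - S" "(x, y) \<in> parcs G"
    using nbr C'(1) x by blast
  let ?D = "\<lparr> verts = {x, y}, arcs = {(x, y), (y, x)}, tail = fst, head = snd \<rparr>"
  have "x \<noteq> y"
    using y loopfree by blast
  have wfD: "wf_digraph ?D"
    by unfold_locales auto
  have "e \<notin> arcs C" for e
  proof
    assume e: "e \<in> arcs C"
    then have "fst e = x" "snd e = x"
      using wf_digraph.wellformed[OF C'(5) e] C'(3,4) x by auto
    with e C'(2) loopfree[of x] show False
      by (metis prod.collapse subsetD)
  qed
  then have "arcs C = {}"
    by blast
  then have "subgraph C ?D"
    using C' x wfD by (auto simp: subgraph_def compatible_def)
  moreover have "subgraph ?D ?H"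
    using y x C' wfD sym wf_delete_verts[of G S]
    by (auto simp: subgraph_def compatible_def delete_verts_simps dest: symD)
  moreover have "connected ?D"
    unfolding connected_iff_cut[OF wfD] by (auto simp: arcs_ends_conv)
  moreover have "?D \<noteq> C"
    using x \<open>x \<noteq> y\<close> by auto
  ultimately show False
    using max by blast
qed

section \<open>Triangular graphs\<close>

text \<open>Distinct non-adjacent vertices have a common neighbour, so the diameter is at most
  2.\<close>

lemma srg_connected:
  assumes srg: "srg v k lam mu G" and "0 < mu" "0 < v"
  shows "connected (with_proj G)"
proof -
  interpret pair_graph G
    using srg by (simp add: srg_def)
  have "y \<in> X"
    if X: "\<forall>(x, y) \<in> parcs G. x \<in> X \<longleftrightarrow> y \<in> X" "x \<in> X" and xy: "x \<in> pverts G" "y \<in> pverts G"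
    for X x y
  proof (cases "x = y \<or> (x, y) \<in> parcs G")
    case True
    with X show ?thesis by blast
  next
    case False
    then have "card (neighbors G x \<inter> neighbors G y) = mu"
      using srg xy by (auto simp: srg_def)
    with \<open>0 < mu\<close> obtain w where "(x, w) \<in> parcs G" "(y, w) \<in> parcs G"
      by (metis (no_types, lifting) IntE card_gt_0_iff equals0I mem_Collect_eq neighbors_def)
    with X show ?thesis by blast
  qed
  then have "X = pverts G"
    if "X \<subseteq> pverts G" "X \<noteq> {}" "\<forall>(x, y) \<in> parcs G. x \<in> X \<longleftrightarrow> y \<in> X" for X
    using that by blast
  moreover have "pverts G \<noteq> {}"
    using srg \<open>0 < v\<close> by (auto simp: srg_def)
  ultimately show ?thesis
    by (simp add: connected_iff_cut[OF wf_digraph_axioms])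
qed

text \<open>Reduces strong regularity to lengths of filtered lists, which can be evaluated. As
  \<open>nat\<close> is injective on the nonnegative codes, these lengths are cardinalities.\<close>

lemma list_graph_srg:
  fixes vs :: "int list" and adj :: "int \<Rightarrow> int \<Rightarrow> bool"
  defines "G \<equiv> \<lparr>pverts = nat ` set vs,
    parcs = {(x, y). x \<in> nat ` set vs \<and> y \<in> nat ` set vs \<and> adj (int x) (int y)}\<rparr>"
  assumes dist: "distinct vs" and nonneg: "\<forall>x \<in> set vs. 0 \<le> x"
    and sym: "\<And>x y. adj x y \<Longrightarrow> adj y x" and irrefl: "\<And>x. \<not> adj x x"
    and deg: "\<forall>x \<in> set vs. length (filter (adj x) vs) = k"
    and common: "\<forall>x \<in> set vs. \<forall>y \<in> set vs. x \<noteq> y \<longrightarrow>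
      length (filter (adj y) (filter (adj x) vs)) = (if adj x y then lam else mu)"
  shows "srg (length vs) k lam mu G"
proof -
  have inj: "inj_on nat X" if "X \<subseteq> set vs" for X
    using nonneg that by (auto simp: inj_on_def subset_iff eq_nat_nat_iff)
  have card_nat: "card (nat ` set ws) = length ws" if "distinct ws" "set ws \<subseteq> set vs" for ws
    using that by (simp add: card_image inj distinct_card)
  have nbr: "neighbors G (nat x) = nat ` set (filter (adj x) vs)" if "x \<in> set vs" for x
    using nonneg that by (force simp: neighbors_def G_def)
  have common': "card (neighbors G (nat x) \<inter> neighbors G (nat y)) = (if adj x y then lam else mu)"
    if xy: "x \<in> set vs" "y \<in> set vs" "x \<noteq> y" for x y
  proof -
    have "neighbors G (nat x) \<inter> neighbors G (nat y) = nat ` (set (filter (adj x) vs) \<inter> set (filter (adj y) vs))"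
      unfolding nbr[OF xy(1)] nbr[OF xy(2)]
      by (subst inj_on_image_Int[OF inj[OF subset_refl]]) auto
    also have "set (filter (adj x) vs) \<inter> set (filter (adj y) vs) = set (filter (adj y) (filter (adj x) vs))"
      by auto
    also have "card (nat ` \<dots>) = (if adj x y then lam else mu)"
      using xy common dist by (subst card_nat) auto
    finally show ?thesis .
  qed
  have deg': "card (neighbors G (nat x)) = k" if "x \<in> set vs" for x
    using that deg dist unfolding nbr[OF that] by (subst card_nat) auto
  have arc: "(nat x, nat y) \<in> parcs G \<longleftrightarrow> adj x y" if "x \<in> set vs" "y \<in> set vs" for x y
    using that nonneg by (auto simp: G_def)
  have verts: "pverts G = nat ` set vs"
    by (simp add: G_def)
  have "finite (parcs G)"
    by (rule finite_subset[of _ "(nat ` set vs) \<times> (nat ` set vs)"]) (auto simp: G_def)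
  moreover have "sym (parcs G)"
    using sym by (auto simp: G_def sym_def)
  moreover have "fst e \<in> pverts G" "snd e \<in> pverts G" "fst e \<noteq> snd e" if "e \<in> parcs G" for e
    using that irrefl[of "int (fst e)"] by (simp_all add: G_def case_prod_beta) metis
  moreover have "finite (pverts G)"
    by (simp add: G_def)
  ultimately have "pair_graph G"
    by unfold_locales (simp_all add: symmetric_def)
  moreover have "card (pverts G) = length vs"
    unfolding verts using card_nat[OF dist subset_refl] .
  moreover have "\<forall>u \<in> pverts G. card (neighbors G u) = k"
    unfolding verts using deg' by blast
  moreover have "card (neighbors G u \<inter> neighbors G w) = (if (u, w) \<in> parcs G then lam else mu)"
    if uw: "u \<in> pverts G" "w \<in> pverts G" "u \<noteq> w" for u w
  proof -
    obtain x y where "x \<in> set vs" "y \<in> set vs" "u = nat x" "w = nat y"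
      using uw verts by blast
    then show ?thesis
      using common'[of x y] arc[of x y] uw(3) by auto
  qed
  moreover have "(u, u) \<notin> parcs G" for u
    using irrefl by (simp add: G_def)
  ultimately show ?thesis
    unfolding srg_def by (metis (full_types))
qed

text \<open>
  For \<open>n \<le> 8\<close> the pair \<open>{i, j}\<close> with \<open>i < j < n\<close> is coded as \<open>8 * i + j\<close>. The codes \<open>1\<close>, \<open>2\<close>, \<open>10\<close> are the
  pairs inside \<open>{0, 1, 2}\<close>. Integers rather than naturals keep the evaluation by rewriting fast.
\<close>

definition pair_codes :: "int \<Rightarrow> int list" where
  "pair_codes n = concat (map (\<lambda>j. map (\<lambda>i. 8 * i + j) [0..j - 1]) [0..n - 1])"

text \<open>\<open>x div 8\<close> and \<open>x mod 8\<close> are the two elements of the coded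
  pair, so this is adjacency in a triangular graph.\<close>

definition meet :: "int \<Rightarrow> int \<Rightarrow> bool" where
  "meet x y \<longleftrightarrow> x \<noteq> y \<and>
    (x div 8 = y div 8 \<or> x mod 8 = y mod 8 \<or> x div 8 = y mod 8 \<or> x mod 8 = y div 8)"

definition triangular_graph :: "int \<Rightarrow> nat pair_pre_digraph" where
  "triangular_graph n = \<lparr>pverts = nat ` set (pair_codes n),
    parcs = {(x, y). x \<in> nat ` set (pair_codes n) \<and> y \<in> nat ` set (pair_codes n) \<and> meet (int x) (int y)}\<rparr>"

definition triangle_boundary :: "int \<Rightarrow> int list" where
  "triangle_boundary n = filter (\<lambda>x. x \<notin> set [1, 2, 10] \<and> list_ex (meet x) [1, 2, 10]) (pair_codes n)"

definition triangular_srg_check :: "int \<Rightarrow> nat \<Rightarrow> nat \<Rightarrow> nat \<Rightarrow> bool" where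
  "triangular_srg_check n k lam mu \<longleftrightarrow> (let vs = pair_codes n in
    distinct vs \<and> list_all (\<lambda>x. 0 \<le> x) vs \<and>
    list_all (\<lambda>x. let nx = filter (meet x) vs in length nx = k \<and>
      list_all (\<lambda>y. if x = y then True else length (filter (meet y) nx) = (if meet x y then lam else mu)) vs) vs)"

definition triangle_boundary_check :: "int \<Rightarrow> nat \<Rightarrow> bool" where
  "triangle_boundary_check n s \<longleftrightarrow>
    (let bd = triangle_boundary n; rest = filter (\<lambda>x. x \<notin> set bd) (pair_codes n) in
      distinct (pair_codes n) \<and> list_all (\<lambda>x. 0 \<le> x) (pair_codes n) \<and>
      length bd = s \<and> list_all (\<lambda>x. x \<in> set rest) [1, 2, 10] \<and> list_ex (\<lambda>x. x \<notin> set [1, 2, 10]) rest \<and>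
      list_all (\<lambda>x. list_ex (meet x) rest) rest)"

text \<open>Once its outer neighbours are deleted, the triangle of pairs inside
  \<open>{0, 1, 2}\<close> is cut off from whatever else is left. The checks supply the finite
  facts; the separation itself follows from the definition of the boundary.\<close>

lemma triangular_counterexample:
  assumes "triangular_srg_check n k lam mu" "triangle_boundary_check n s" "length (pair_codes n) = v"
    and mu: "0 < mu" and s: "int s < 2 * int k - int lam - 2"
  shows "\<exists>G :: nat pair_pre_digraph. srg v k lam mu G \<and>
    (\<exists>S. disconnecting_set G S \<and> (\<forall>C \<in> components (delete_verts G S). card (verts C) \<ge> 2) \<and>
      int (card S) < 2 * int k - int lam - 2)"
proof -
  let ?G = "triangular_graph n" and ?vs = "pair_codes n"
  define bd where "bd = triangle_boundary n"
  define rest where "rest = filter (\<lambda>x. x \<notin> set bd) ?vs"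
  have meet_sym: "meet x y \<Longrightarrow> meet y x" for x y
    by (auto simp: meet_def)
  have srg: "srg v k lam mu ?G"
    unfolding triangular_graph_def assms(3)[symmetric]
  proof (rule list_graph_srg)
    show "\<not> meet x x" for x
      by (simp add: meet_def)
  qed (use assms(1) meet_sym in
      \<open>auto simp: triangular_srg_check_def Let_def list_all_iff simp del: filter_filter\<close>)
  define T :: "int set" where "T = set [1, 2, 10]"
  have chk0: "distinct ?vs \<and> (\<forall>x \<in> set ?vs. 0 \<le> x) \<and> length bd = s \<and> (\<forall>x \<in> T. x \<in> set rest) \<and>
    (\<exists>x \<in> set rest. x \<notin> T) \<and> (\<forall>x \<in> set rest. \<exists>y \<in> set rest. meet x y)"
    using assms(2) unfolding triangle_boundary_check_def Let_def list_all_iff list_ex_iff bd_def rest_def T_def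
    by assumption
  note chk = conjunct1[OF chk0] conjunct1[OF conjunct2[OF chk0]]
    conjunct1[OF conjunct2[OF conjunct2[OF chk0]]] conjunct1[OF conjunct2[OF conjunct2[OF conjunct2[OF chk0]]]]
    conjunct1[OF conjunct2[OF conjunct2[OF conjunct2[OF conjunct2[OF chk0]]]]]
    conjunct2[OF conjunct2[OF conjunct2[OF conjunct2[OF conjunct2[OF chk0]]]]]
  have T: "T \<subseteq> set rest" "T \<noteq> {}"
    using chk(4) by (auto simp: T_def)
  have sub: "set bd \<subseteq> set ?vs" "distinct bd" "set rest = set ?vs - set bd"
    using chk(1) by (auto simp: bd_def triangle_boundary_def rest_def)
  have inj: "inj_on nat (set ?vs)"
    using chk(2) by (auto simp: inj_on_def eq_nat_nat_iff)
  let ?S = "nat ` set bd"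
  have rest: "pverts ?G - ?S = nat ` set rest"
    using sub inj by (auto simp: triangular_graph_def inj_on_def)
  have arc: "(nat x, nat y) \<in> parcs ?G \<longleftrightarrow> meet x y" if "x \<in> set ?vs" "y \<in> set ?vs" for x y
    using that chk(2) by (auto simp: triangular_graph_def)
  have no_loop: "(y, y) \<notin> parcs ?G" for y
    by (auto simp: triangular_graph_def meet_def)
  have symm: "sym (parcs ?G)"
    using meet_sym by (auto simp: triangular_graph_def sym_def)
  have "\<forall>x \<in> pverts ?G - ?S. \<exists>y \<in> pverts ?G - ?S. (x, y) \<in> parcs ?G"
    using chk(6) arc sub(3) unfolding rest by fastforce
  then have comps: "\<forall>C \<in> components (delete_verts ?G ?S). card (verts C) \<ge> 2"
    using components_if_no_isolated_vertex[OF no_loop symm] by (simp add: triangular_graph_def)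
  let ?X = "nat ` T"
  have closed: "nat x \<in> ?X \<longleftrightarrow> nat y \<in> ?X" if "x \<in> set rest" "y \<in> set rest" "meet x y" for x y
  proof -
    \<comment> \<open>A remaining vertex that meets the triangle lies in it, since otherwise it
      would belong to the deleted boundary.\<close>
    have "z \<in> T" if "z \<in> set rest" "list_ex (meet z) [1, 2, 10]" for z
      using that unfolding rest_def bd_def triangle_boundary_def T_def by auto
    then have "x \<in> T \<longleftrightarrow> y \<in> T"
      using that meet_sym unfolding T_def list_ex_iff by blast
    moreover have "nat z \<in> ?X \<longleftrightarrow> z \<in> T" if "z \<in> set rest" for z
      using that T sub(3) inj_on_image_mem_iff[OF inj, of z "T"] by blast
    ultimately show ?thesis
      using that by blast
  qed
  have "x \<in> ?X \<longleftrightarrow> y \<in> ?X"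
    if xy: "(x, y) \<in> parcs ?G" "x \<in> nat ` set rest" "y \<in> nat ` set rest" for x y
  proof -
    obtain x' y' where *: "x = nat x'" "y = nat y'" "x' \<in> set rest" "y' \<in> set rest"
      using xy(2,3) by blast
    moreover have "meet x' y'"
      using xy(1) * arc[of x' y'] sub(3) by simp
    ultimately show ?thesis
      using closed by simp
  qed
  then have "\<forall>(x, y) \<in> arcs_ends (delete_verts ?G ?S). x \<in> ?X \<longleftrightarrow> y \<in> ?X"
    unfolding delete_verts_simps rest by blast
  moreover have "?X \<subseteq> nat ` set rest" "?X \<noteq> {}"
    using image_mono[OF T(1)] T(2) by simp_all
  moreover have "?X \<noteq> nat ` set rest"
  proof -
    have "T \<noteq> set rest"
      using chk(5) by blast
    then show ?thesis
      using inj_on_image_eq_iff[OF inj, of "T" "set rest"] T sub(3) by blast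
  qed
  ultimately have "\<not> connected (delete_verts ?G ?S)"
    unfolding connected_iff_cut[OF wf_delete_verts] delete_verts_simps(1) rest by blast
  moreover have "connected (with_proj ?G)"
    using T sub(3) assms(3) by (intro srg_connected[OF srg mu]) auto
  moreover have "?S \<subseteq> pverts ?G"
    using sub(1) by (auto simp: triangular_graph_def)
  moreover have "pverts ?G - ?S \<noteq> {}"
    unfolding rest using chk(5) by auto
  ultimately have disc: "disconnecting_set ?G ?S"
    by (simp add: disconnecting_set_def)
  have "card ?S = s"
    using card_image[OF inj_on_subset[OF inj sub(1)]] distinct_card[OF sub(2)] chk(3) by simp
  then have "int (card ?S) < 2 * int k - int lam - 2"
    using s by simp
  with disc comps show ?thesis
    by (intro exI[of _ ?G] conjI[OF srg] exI[of _ ?S] conjI)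
qed

text \<open>\<open>T(n)\<close> has parameters
  \<open>(n * (n - 1) / 2, 2 * (n - 2), n - 2, 4)\<close>, and the boundary of the triangle has
  \<open>3 * (n - 3)\<close> vertices.\<close>

lemma triangular_check_6:
  "triangular_srg_check 6 8 4 4" "triangle_boundary_check 6 9" "length (pair_codes 6) = 15"
  by code_simp+

lemma triangular_check_7:
  "triangular_srg_check 7 10 5 4" "triangle_boundary_check 7 12" "length (pair_codes 7) = 21"
  by code_simp+

lemma triangular_check_8:
  "triangular_srg_check 8 12 6 4" "triangle_boundary_check 8 15" "length (pair_codes 8) = 28"
  by code_simp+

section \<open>Traces of idempotents\<close>

lemma sum_diag_mult_comm:
  fixes A B :: "'a :: comm_semiring_0 mat"
  assumes "A \<in> carrier_mat n n" "B \<in> carrier_mat n n"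
  shows "(\<Sum>i<n. (A * B) $$ (i, i)) = (\<Sum>i<n. (B * A) $$ (i, i))"
proof -
  have "(\<Sum>i<n. (A * B) $$ (i, i)) = (\<Sum>i<n. \<Sum>j<n. A $$ (i, j) * B $$ (j, i))"
    using assms by (simp add: scalar_prod_def atLeast0LessThan)
  also have "\<dots> = (\<Sum>j<n. \<Sum>i<n. B $$ (j, i) * A $$ (i, j))"
    by (subst sum.swap) (simp add: mult.commute)
  also have "\<dots> = (\<Sum>i<n. (B * A) $$ (i, i))"
    using assms by (simp add: scalar_prod_def atLeast0LessThan)
  finally show ?thesis .
qed

text \<open>By Schur, \<open>E\<close> is similar to a triangular matrix, again idempotent, whose
  diagonal entries therefore solve \<open>b = b * b\<close>. The trace counts the ones among
  them.\<close>

lemma idempotent_mat_trace: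
  fixes E :: "complex mat"
  assumes E: "E \<in> carrier_mat n n" and idem: "E * E = E"
  shows "\<exists>j \<le> n. (\<Sum>i<n. E $$ (i, i)) = of_nat j"
proof -
  obtain es where "char_poly E = (\<Prod>e \<leftarrow> es. [:- e, 1:])"
    using char_poly_factorized[OF E] by blast
  moreover obtain B P Q where "schur_decomposition E es = (B, P, Q)"
    by (cases "schur_decomposition E es") auto
  ultimately have sim: "similar_mat_wit E B P Q" and ut: "upper_triangular B"
    using schur_decomposition[OF E] by blast+
  note d = similar_mat_witD2[OF E sim]
  note car = d(4-7)
  have B_eq: "B = Q * E * P"
  proof -
    have "Q * E * P = Q * (P * B * Q) * P" using d(3) by simp
    also have "\<dots> = (Q * P) * B * (Q * P)" using car by (simp add: assoc_mult_mat[of _ n n _ n _ n])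
    finally show ?thesis using car d(2) by simp
  qed
  have "B * B = Q * E * (P * Q) * E * P"
    unfolding B_eq using car by (simp add: assoc_mult_mat[of _ n n _ n _ n])
  also have "\<dots> = Q * (E * E) * P"
    using d(1) car by (simp add: assoc_mult_mat[of _ n n _ n _ n])
  finally have B_idem: "B * B = B"
    using idem B_eq by simp
  have diag: "B $$ (i, i) = 0 \<or> B $$ (i, i) = 1" if i: "i < n" for i
  proof -
    have "B $$ (i, i) = (\<Sum>j<n. B $$ (i, j) * B $$ (j, i))"
      using arg_cong[OF B_idem, of "\<lambda>M. M $$ (i, i)"] car i by (simp add: scalar_prod_def atLeast0LessThan)
    \<comment> \<open>For \<open>j\<close> other than \<open>i\<close> one of the two factors
      vanishes, because \<open>B\<close> is triangular.\<close>
    also have "\<dots> = (\<Sum>j<n. if j = i then B $$ (i, i) * B $$ (i, i) else 0)"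
    proof (rule sum.cong)
      fix j assume "j \<in> {..<n}"
      then show "B $$ (i, j) * B $$ (j, i) = (if j = i then B $$ (i, i) * B $$ (i, i) else 0)"
        using upper_triangularD[OF ut, of j i] upper_triangularD[OF ut, of i j] car i
        by (cases "j < i"; cases "i < j") auto
    qed simp
    finally show ?thesis
      using i by simp
  qed
  have "(\<Sum>i<n. E $$ (i, i)) = (\<Sum>i<n. (P * (B * Q)) $$ (i, i))"
    using d(3) car by (simp add: assoc_mult_mat[of _ n n _ n _ n])
  also have "\<dots> = (\<Sum>i<n. (B * Q * P) $$ (i, i))"
    using car by (intro sum_diag_mult_comm) auto
  also have "\<dots> = (\<Sum>i<n. B $$ (i, i))"
    using car d(2) by (simp add: assoc_mult_mat[of _ n n _ n _ n])
  also have "\<dots> = (\<Sum>i<n. of_bool (B $$ (i, i) = 1))"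
    using diag by (intro sum.cong) auto
  also have "\<dots> = of_nat (card {i \<in> {..<n}. B $$ (i, i) = 1})"
    by (simp add: of_bool_def sum.If_cases Int_def)
  finally show ?thesis
    using card_mono[of "{..<n}" "{i \<in> {..<n}. B $$ (i, i) = 1}"] by auto
qed

text \<open>An enumeration of \<open>V\<close> turns the kernel into a matrix, taken over the
  complex numbers so that its characteristic polynomial splits.\<close>

lemma idempotent_kernel_trace:
  fixes e :: "'a \<Rightarrow> 'a \<Rightarrow> real"
  assumes fin: "finite V"
    and idem: "\<And>x y. x \<in> V \<Longrightarrow> y \<in> V \<Longrightarrow> (\<Sum>z\<in>V. e x z * e z y) = e x y"
  shows "\<exists>j \<le> card V. (\<Sum>x\<in>V. e x x) = real j"
proof -
  let ?n = "card V"
  obtain f where f: "bij_betw f {..<?n} V"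
    using ex_bij_betw_nat_finite[OF fin] by (auto simp: atLeast0LessThan)
  have fV: "f i \<in> V" if "i < ?n" for i
    using f that by (auto simp: bij_betw_def)
  define E where "E = mat ?n ?n (\<lambda>(i, j). complex_of_real (e (f i) (f j)))"
  have E: "E \<in> carrier_mat ?n ?n"
    by (simp add: E_def)
  have "E * E = E"
  proof (rule eq_matI)
    fix i j assume "i < dim_row E" "j < dim_col E"
    then have ij: "i < ?n" "j < ?n"
      by (auto simp: E_def)
    have "(E * E) $$ (i, j) = complex_of_real (\<Sum>h<?n. e (f i) (f h) * e (f h) (f j))"
      using ij by (simp add: E_def scalar_prod_def atLeast0LessThan)
    also have "(\<Sum>h<?n. e (f i) (f h) * e (f h) (f j)) = (\<Sum>z\<in>V. e (f i) z * e z (f j))"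
      using sum.reindex_bij_betw[OF f] by simp
    also have "\<dots> = e (f i) (f j)"
      using ij fV idem by simp
    finally show "(E * E) $$ (i, j) = E $$ (i, j)"
      using ij by (simp add: E_def)
  qed (auto simp: E_def)
  from idempotent_mat_trace[OF E this] obtain j
    where j: "j \<le> ?n" "(\<Sum>i<?n. E $$ (i, i)) = of_nat j"
    by blast
  have "complex_of_real (\<Sum>x\<in>V. e x x) = (\<Sum>i<?n. E $$ (i, i))"
    using sum.reindex_bij_betw[OF f, of "\<lambda>x. e x x"] by (simp add: E_def flip: of_real_sum)
  also have "\<dots> = complex_of_real (real j)"
    using j by simp
  finally show ?thesis
    using j(1) by (metis of_real_eq_iff)
qed

section \<open>Counting neighbours in a separator\<close>

text \<open>
  The minimum of the sum of squares of \<open>n\<close> integers with sum \<open>t\<close>: summing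
  \<open>(x - c) * (x - (c + 1)) \<ge> 0\<close> gives the formula.
\<close>

definition min_square_sum :: "int \<Rightarrow> int \<Rightarrow> int" where
  "min_square_sum t n = (let c = t div n in (2 * c + 1) * t - c * (c + 1) * n)"

text \<open>
  For a part with \<open>a\<close> vertices and inner degree sum \<open>d\<close>, this bounds the sum over the separator of the
  squared numbers of neighbours in that part.
\<close>

definition moment_bound :: "int \<Rightarrow> int \<Rightarrow> int \<Rightarrow> int \<Rightarrow> int \<Rightarrow> int" where
  "moment_bound k lam mu a d = k * a + mu * a * (a - 1) + (lam - mu) * d - min_square_sum d a"

text \<open>No integer lies strictly between \<open>c\<close> and \<open>c + 1\<close>, so every
  product is nonnegative; taking \<open>c\<close> as the floor of the mean makes the bound sharp. If
  \<open>card A\<close> is 0, the sums vanish and division by zero gives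
  \<open>c = 0\<close>.\<close>

lemma min_square_sum_le:
  fixes f :: "'a \<Rightarrow> int"
  shows "min_square_sum (\<Sum>x\<in>A. f x) (int (card A)) \<le> (\<Sum>x\<in>A. (f x)\<^sup>2)"
proof -
  define c where "c = (\<Sum>x\<in>A. f x) div int (card A)"
  have nonneg: "0 \<le> (y - c) * (y - (c + 1))" for y
  proof (cases "y \<le> c")
    case True
    then show ?thesis by (intro mult_nonpos_nonpos) auto
  next
    case False
    then show ?thesis by (intro mult_nonneg_nonneg) auto
  qed
  have "0 \<le> (\<Sum>x\<in>A. (f x - c) * (f x - (c + 1)))"
    using nonneg by (rule sum_nonneg)
  also have "\<dots> = (\<Sum>x\<in>A. (f x)\<^sup>2 - (2 * c + 1) * f x + c * (c + 1))"
    by (rule sum.cong) (auto simp: algebra_simps power2_eq_square)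
  also have "\<dots> = (\<Sum>x\<in>A. (f x)\<^sup>2) - (2 * c + 1) * (\<Sum>x\<in>A. f x) + c * (c + 1) * int (card A)"
    unfolding sum.distrib sum_subtractf sum_distrib_left[symmetric] by (simp add: algebra_simps)
  finally show ?thesis
    by (simp add: min_square_sum_def c_def Let_def)
qed

text \<open>Lagrange's identity: the double sum of squared 2 by 2 minors is twice the difference of
  the two sides.\<close>

lemma Cauchy_Schwarz_sum_int:
  fixes f g :: "'a \<Rightarrow> int"
  shows "(\<Sum>x\<in>A. f x * g x)\<^sup>2 \<le> (\<Sum>x\<in>A. (f x)\<^sup>2) * (\<Sum>x\<in>A. (g x)\<^sup>2)"
proof -
  have "0 \<le> (\<Sum>x\<in>A. \<Sum>y\<in>A. (f x * g y - f y * g x)\<^sup>2)"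
    by (intro sum_nonneg) simp
  also have "\<dots> = (\<Sum>x\<in>A. \<Sum>y\<in>A. (f x)\<^sup>2 * (g y)\<^sup>2) + (\<Sum>x\<in>A. \<Sum>y\<in>A. (g x)\<^sup>2 * (f y)\<^sup>2)
      - 2 * (\<Sum>x\<in>A. \<Sum>y\<in>A. (f x * g x) * (f y * g y))"
    by (simp add: power2_eq_square algebra_simps sum.distrib sum_subtractf sum_distrib_left)
  also have "\<dots> = 2 * ((\<Sum>x\<in>A. (f x)\<^sup>2) * (\<Sum>x\<in>A. (g x)\<^sup>2)) - 2 * (\<Sum>x\<in>A. f x * g x)\<^sup>2"
    by (simp add: sum_product[symmetric] power2_eq_square)
  finally show ?thesis
    by simp
qed

text \<open>Cauchy--Schwarz for the deviations from the mean, multiplied by \<open>n\<close> to stay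
  integral. Replacing the second moments by \<open>F\<close> and \<open>G\<close> is monotone
  because the variances are nonnegative.\<close>

lemma covariance_square_le:
  fixes f g :: "'a \<Rightarrow> int" and A :: "'a set" and F G :: int
  defines "n \<equiv> int (card A)"
  assumes fin: "finite A"
    and F: "(\<Sum>x\<in>A. (f x)\<^sup>2) \<le> F" and G: "(\<Sum>x\<in>A. (g x)\<^sup>2) \<le> G"
  shows "(n * (\<Sum>x\<in>A. f x * g x) - (\<Sum>x\<in>A. f x) * (\<Sum>x\<in>A. g x))\<^sup>2
    \<le> (n * F - (\<Sum>x\<in>A. f x)\<^sup>2) * (n * G - (\<Sum>x\<in>A. g x)\<^sup>2)"
    (is "?c\<^sup>2 \<le> _")
proof (cases "A = {}")
  case True
  then show ?thesis by (simp add: n_def)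
next
  case False
  then have n: "0 < n"
    using fin by (simp add: n_def card_gt_0_iff)
  have centred: "(\<Sum>x\<in>A. (n * p x - (\<Sum>x\<in>A. p x)) * (n * q x - (\<Sum>x\<in>A. q x)))
      = n * (n * (\<Sum>x\<in>A. p x * q x) - (\<Sum>x\<in>A. p x) * (\<Sum>x\<in>A. q x))" for p q :: "'a \<Rightarrow> int"
  proof -
    let ?P = "\<Sum>x\<in>A. p x" and ?Q = "\<Sum>x\<in>A. q x"
    have "(\<Sum>x\<in>A. (n * p x - ?P) * (n * q x - ?Q))
        = (\<Sum>x\<in>A. n * n * (p x * q x) - n * ?Q * p x - n * ?P * q x + ?P * ?Q)"
      by (rule sum.cong) (auto simp: algebra_simps)
    also have "\<dots> = n * n * (\<Sum>x\<in>A. p x * q x) - n * ?Q * ?P - n * ?P * ?Q + n * (?P * ?Q)"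
      unfolding sum.distrib sum_subtractf sum_distrib_left[symmetric] by (simp add: n_def)
    finally show ?thesis
      by (simp add: algebra_simps)
  qed
  let ?vf = "n * (\<Sum>x\<in>A. (f x)\<^sup>2) - (\<Sum>x\<in>A. f x)\<^sup>2"
  let ?vg = "n * (\<Sum>x\<in>A. (g x)\<^sup>2) - (\<Sum>x\<in>A. g x)\<^sup>2"
  have var: "(\<Sum>x\<in>A. (n * p x - (\<Sum>x\<in>A. p x))\<^sup>2) = n * (n * (\<Sum>x\<in>A. (p x)\<^sup>2) - (\<Sum>x\<in>A. p x)\<^sup>2)"
    for p :: "'a \<Rightarrow> int"
    using centred[of p p] by (simp add: power2_eq_square)
  have "(n * ?c)\<^sup>2 \<le> (n * ?vf) * (n * ?vg)"
    using Cauchy_Schwarz_sum_int[of "\<lambda>x. n * f x - (\<Sum>x\<in>A. f x)" "\<lambda>x. n * g x - (\<Sum>x\<in>A. g x)" A]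
    unfolding centred var .
  then have "n\<^sup>2 * ?c\<^sup>2 \<le> n\<^sup>2 * (?vf * ?vg)"
    by (simp add: power2_eq_square algebra_simps)
  then have "?c\<^sup>2 \<le> ?vf * ?vg"
    using n by simp
  moreover have "0 \<le> n * ?vf" "0 \<le> n * ?vg"
    unfolding var[symmetric] by (auto intro: sum_nonneg)
  then have "0 \<le> ?vf" "0 \<le> ?vg"
    using n by (simp_all add: zero_le_mult_iff)
  moreover have "?vf \<le> n * F - (\<Sum>x\<in>A. f x)\<^sup>2" "?vg \<le> n * G - (\<Sum>x\<in>A. g x)\<^sup>2"
    using F G n by simp_all
  ultimately show ?thesis
    by (meson mult_mono order_trans)
qed

section \<open>Double counting in strongly regular graphs\<close>

locale strongly_regular = pair_graph G for G :: "'a pair_pre_digraph" +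
  fixes v k lam mu :: nat
  assumes srg: "srg v k lam mu G"
begin

abbreviation "V \<equiv> pverts G"
abbreviation "N \<equiv> neighbors G"

lemma mem_N: "y \<in> N x \<longleftrightarrow> (x, y) \<in> parcs G"
  using in_arcsD2 by (auto simp: neighbors_def)

lemma N_sym: "y \<in> N x \<longleftrightarrow> x \<in> N y"
  using pair_sym_arcs by (auto simp: mem_N symmetric_def dest: symD)

lemma N_subset: "N x \<subseteq> V"
  by (auto simp: neighbors_def)

lemma N_irrefl: "x \<notin> N x"
  using pair_no_loops[of "(x, x)"] by (auto simp: mem_N)

lemma finite_N [simp]: "finite (N x)"
  using N_subset pair_finite_verts finite_subset by blast

lemma card_N: "x \<in> V \<Longrightarrow> card (N x) = k"
  using srg by (simp add: srg_def)

lemma card_V: "card V = v"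
  using srg by (simp add: srg_def)

lemma card_common_neighbors:
  assumes "x \<in> V" "y \<in> V"
  shows "card (N x \<inter> N y) = (if x = y then k else if y \<in> N x then lam else mu)"
  using srg assms by (auto simp: srg_def mem_N)

lemma sum_neighbor_counts:
  assumes "A \<subseteq> V"
  shows "(\<Sum>z\<in>V. int (card (N z \<inter> A))) = int k * int (card A)"
proof -
  have fin: "finite A"
    using assms pair_finite_verts finite_subset by blast
  have "(\<Sum>z\<in>V. int (card (N z \<inter> A))) = (\<Sum>z\<in>V. \<Sum>x\<in>A. of_bool (x \<in> N z))"
    using fin by (simp add: Int_commute)
  also have "\<dots> = (\<Sum>x\<in>A. \<Sum>z\<in>V. of_bool (z \<in> N x))"
    by (subst sum.swap) (simp add: N_sym)
  also have "\<dots> = (\<Sum>x\<in>A. int (card (N x)))"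
    using pair_finite_verts N_subset by (simp add: Int_absorb1)
  also have "\<dots> = int k * int (card A)"
    using assms card_N by (simp add: subset_iff)
  finally show ?thesis .
qed

text \<open>Both sides count the triples of a vertex \<open>z\<close>, a neighbour of
  \<open>z\<close> in \<open>A\<close> and a neighbour of \<open>z\<close> in
  \<open>B\<close>.\<close>

lemma sum_neighbor_count_products:
  assumes "A \<subseteq> V" "B \<subseteq> V"
  shows "(\<Sum>z\<in>V. int (card (N z \<inter> A)) * int (card (N z \<inter> B))) = (\<Sum>x\<in>A. \<Sum>y\<in>B. int (card (N x \<inter> N y)))"
proof -
  have fin: "finite A" "finite B"
    using assms pair_finite_verts finite_subset by blast+
  have "(\<Sum>z\<in>V. int (card (N z \<inter> A)) * int (card (N z \<inter> B)))
      = (\<Sum>z\<in>V. (\<Sum>x\<in>A. of_bool (x \<in> N z)) * (\<Sum>y\<in>B. of_bool (y \<in> N z)))"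
    using fin by (simp add: Int_commute)
  also have "\<dots> = (\<Sum>z\<in>V. \<Sum>x\<in>A. \<Sum>y\<in>B. of_bool (z \<in> N x \<inter> N y))"
    by (simp add: sum_product N_sym of_bool_conj)
  also have "\<dots> = (\<Sum>x\<in>A. \<Sum>y\<in>B. \<Sum>z\<in>V. of_bool (z \<in> N x \<inter> N y))"
    by (subst sum.swap, rule sum.cong[OF refl], subst sum.swap) simp
  also have "\<dots> = (\<Sum>x\<in>A. \<Sum>y\<in>B. int (card (N x \<inter> N y)))"
  proof -
    have "(\<Sum>z\<in>V. of_bool (z \<in> N x \<inter> N y)) = int (card (N x \<inter> N y))" for x y
    proof -
      have "V \<inter> {z. z \<in> N x \<inter> N y} = N x \<inter> N y"
        using N_subset by auto
      then show ?thesis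
        using pair_finite_verts by (simp del: Int_iff)
    qed
    then show ?thesis by simp
  qed
  finally show ?thesis .
qed

text \<open>This is \<open>M^2 = k I + lam M + mu (J - I - M)\<close> for the adjacency matrix
  \<open>M\<close>, summed over the block \<open>A x A\<close>.\<close>

lemma sum_common_neighbors:
  assumes "A \<subseteq> V"
  shows "(\<Sum>x\<in>A. \<Sum>y\<in>A. int (card (N x \<inter> N y))) =
    int k * int (card A) + int mu * int (card A) * (int (card A) - 1)
      + (int lam - int mu) * (\<Sum>x\<in>A. int (card (N x \<inter> A)))"
proof -
  have fin: "finite A"
    using assms pair_finite_verts finite_subset by blast
  have "(\<Sum>y\<in>A. int (card (N x \<inter> N y)))
      = int k + int mu * (int (card A) - 1) + (int lam - int mu) * int (card (N x \<inter> A))"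
    if x: "x \<in> A" for x
  proof -
    have "(\<Sum>y\<in>A. int (card (N x \<inter> N y)))
        = (\<Sum>y\<in>A. int mu + (int lam - int mu) * of_bool (y \<in> N x) + (int k - int mu) * of_bool (y = x))"
      using assms x N_irrefl by (intro sum.cong) (auto simp: card_common_neighbors subset_iff)
    also have "\<dots> = int mu * int (card A) + (int lam - int mu) * int (card (A \<inter> {y. y \<in> N x}))
        + (int k - int mu) * int (card (A \<inter> {y. y = x}))"
      using fin unfolding sum.distrib sum_distrib_left[symmetric] by simp
    also have "A \<inter> {y. y = x} = {x}"
      using x by auto
    finally show ?thesis
      by (simp add: algebra_simps Int_commute)
  qed
  then have "(\<Sum>x\<in>A. \<Sum>y\<in>A. int (card (N x \<inter> N y))) =
      (\<Sum>x\<in>A. int k + int mu * (int (card A) - 1) + (int lam - int mu) * int (card (N x \<inter> A)))"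
    by (rule sum.cong[OF refl])
  also have "\<dots> = int (card A) * (int k + int mu * (int (card A) - 1))
      + (int lam - int mu) * (\<Sum>x\<in>A. int (card (N x \<inter> A)))"
    unfolding sum.distrib sum_distrib_left[symmetric] by (simp add: algebra_simps)
  finally show ?thesis
    by (simp add: algebra_simps)
qed

text \<open>The two preceding counts with \<open>A = B = V\<close> evaluate the sum of the squared
  degrees; then \<open>v\<close> cancels.\<close>

lemma parameter_equation:
  assumes "0 < v"
  shows "int k * (int k - 1 - int lam) = (int v - int k - 1) * int mu"
proof -
  have "(\<Sum>z\<in>V. int (card (N z \<inter> V)) * int (card (N z \<inter> V))) = int v * (int k * int k)"
    using card_N N_subset card_V by (simp add: Int_absorb2)
  then have "int v * (int k * int k) = int k * int v + int mu * int v * (int v - 1) + (int lam - int mu) * (int v * int k)"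
    using sum_neighbor_count_products[of V V] sum_common_neighbors[of V] card_N N_subset card_V
    by (simp add: Int_absorb2)
  then have "int v * (int k * (int k - 1 - int lam)) = int v * ((int v - int k - 1) * int mu)"
    by (simp add: algebra_simps)
  then show ?thesis
    using assms by simp
qed

lemma edge_neighborhood:
  assumes "x \<in> V" "y \<in> N x" "N x \<union> N y \<subseteq> X" "finite X"
  shows "2 * int k - int lam \<le> int (card X)"
proof -
  have y: "y \<in> V" "x \<noteq> y"
    using assms N_subset N_irrefl by auto
  have "card (N x \<union> N y) + card (N x \<inter> N y) = 2 * k"
    using card_Un_Int[of "N x" "N y"] card_N assms(1) y by simp
  moreover have "card (N x \<inter> N y) = lam"
    using assms y by (simp add: card_common_neighbors)
  moreover have "card (N x \<union> N y) \<le> card X"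
    using assms by (simp add: card_mono)
  ultimately show ?thesis
    by linarith
qed

text \<open>The constraints on one side of a separation make no reference to the other side, so both
  sides can use them.\<close>

lemma part_bounds:
  fixes A S :: "'a set"
  defines "a \<equiv> int (card A)" and "s \<equiv> int (card S)" and "d \<equiv> (\<Sum>x\<in>A. int (card (N x \<inter> A)))"
  assumes sub: "A \<subseteq> V" "S \<subseteq> V" "A \<inter> S = {}" and "A \<noteq> {}"
    and sep: "\<forall>x \<in> A. N x \<subseteq> A \<union> S"
    and nbr: "\<forall>x \<in> A. N x \<inter> A \<noteq> {}"
    and small: "s < 2 * int k - int lam - 2"
  shows "a + 1 \<le> d" "d \<le> a * (a - 1)" "2 * int k - int lam \<le> a + s"
    "(\<Sum>z\<in>S. int (card (N z \<inter> A))) = int k * a - d"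
    "(\<Sum>z\<in>S. (int (card (N z \<inter> A)))\<^sup>2) \<le> moment_bound k lam mu a d"
    "min_square_sum (int k * a - d) s \<le> moment_bound k lam mu a d"
proof -
  have fin: "finite A" "finite S"
    using sub pair_finite_verts finite_subset by blast+
  have deg_pos: "1 \<le> card (N x \<inter> A)" if "x \<in> A" for x
    using nbr that by (simp add: Suc_leI card_gt_0_iff)
  obtain x y where xy: "x \<in> A" "y \<in> A" "y \<in> N x"
    using \<open>A \<noteq> {}\<close> nbr by blast
  have edge: "2 * int k - int lam \<le> int (card X)" if "N x \<union> N y \<subseteq> X" "finite X" for X
    using edge_neighborhood[of x y X] xy sub that by blast
  have "2 * int k - int lam \<le> int (card (A \<union> S))"
    using edge[of "A \<union> S"] sep xy fin by blast
  then show "2 * int k - int lam \<le> a + s"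
    using fin sub by (simp add: card_Un_disjoint a_def s_def)
  \<comment> \<open>If \<open>d = a\<close>, all inner degrees are 1 and the edge \<open>xy\<close>
    is a component. Its neighbourhood then lies in \<open>{x, y} \<union> S\<close>, which has at
    most \<open>s + 2\<close> elements, fewer than \<open>2 * k - lam\<close>.\<close>
  have "d \<noteq> a"
  proof
    assume "d = a"
    then have "(\<Sum>x\<in>A. int (card (N x \<inter> A)) - 1) = 0"
      by (simp add: d_def a_def sum_subtractf)
    then have "card (N z \<inter> A) = 1" if "z \<in> A" for z
      using sum_nonneg_eq_0_iff[of A "\<lambda>x. int (card (N x \<inter> A)) - 1"] fin deg_pos that by fastforce
    then have one: "\<exists>w. N z \<inter> A = {w}" if "z \<in> A" for z
      using that card_1_singletonE by metis
    obtain x' where "N y \<inter> A = {x'}"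
      using one[OF xy(2)] by blast
    moreover obtain y' where "N x \<inter> A = {y'}"
      using one[OF xy(1)] by blast
    moreover have "x \<in> N y \<inter> A" "y \<in> N x \<inter> A"
      using xy N_sym by auto
    ultimately have "N x \<inter> A = {y}" "N y \<inter> A = {x}"
      by (metis singletonD)+
    then have "N x \<union> N y \<subseteq> {x, y} \<union> S"
      using sep xy(1,2) by blast
    then have "2 * int k - int lam \<le> int (card ({x, y} \<union> S))"
      by (rule edge) (simp add: fin)
    also have "card ({x, y} \<union> S) \<le> 2 + card S"
      using card_Un_le[of "{x, y}" S] card_insert_le_m1[of 2 "{y}" x] by simp
    finally show False
      using small by (simp add: s_def)
  qed
  moreover have "a \<le> d"
    using sum_mono[of A "\<lambda>_. 1" "\<lambda>x. int (card (N x \<inter> A))"] deg_pos by (simp add: a_def d_def)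
  ultimately show "a + 1 \<le> d"
    by simp
  have "int (card (N z \<inter> A)) \<le> a - 1" if "z \<in> A" for z
  proof -
    have "N z \<inter> A \<subset> A"
      using N_irrefl that by blast
    then have "card (N z \<inter> A) < card A"
      using fin by (simp add: psubset_card_mono)
    then show ?thesis
      by (simp add: a_def)
  qed
  then show "d \<le> a * (a - 1)"
    using sum_bounded_above[of A "\<lambda>x. int (card (N x \<inter> A))" "a - 1"] by (simp add: a_def d_def)
  \<comment> \<open>A vertex outside \<open>A \<union> S\<close> has no neighbour in
    \<open>A\<close>, so with \<open>h 0 = 0\<close> it contributes nothing.\<close>
  have split: "(\<Sum>z\<in>V. h (card (N z \<inter> A))) = (\<Sum>z\<in>A. h (card (N z \<inter> A))) + (\<Sum>z\<in>S. h (card (N z \<inter> A)))"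
    if "h 0 = 0" for h :: "nat \<Rightarrow> int"
  proof -
    have "(\<Sum>z\<in>V. h (card (N z \<inter> A))) = (\<Sum>z\<in>A \<union> S. h (card (N z \<inter> A)))"
    proof (rule sum.mono_neutral_right)
      show "\<forall>z \<in> V - (A \<union> S). h (card (N z \<inter> A)) = 0"
      proof
        fix z assume "z \<in> V - (A \<union> S)"
        then have "N z \<inter> A = {}"
          using sep N_sym by blast
        then show "h (card (N z \<inter> A)) = 0"
          using that by simp
      qed
    qed (use sub pair_finite_verts in auto)
    then show ?thesis
      using fin sub by (simp add: sum.union_disjoint)
  qed
  show sum_S: "(\<Sum>z\<in>S. int (card (N z \<inter> A))) = int k * a - d"
    using split[of int] sum_neighbor_counts[OF sub(1)] by (simp add: a_def d_def)
  have "(\<Sum>z\<in>V. (int (card (N z \<inter> A)))\<^sup>2)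
      = int k * a + int mu * a * (a - 1) + (int lam - int mu) * d"
    using sum_neighbor_count_products[OF sub(1) sub(1)] sum_common_neighbors[OF sub(1)]
    by (simp add: power2_eq_square a_def d_def)
  moreover have "min_square_sum d a \<le> (\<Sum>z\<in>A. (int (card (N z \<inter> A)))\<^sup>2)"
    unfolding d_def a_def by (rule min_square_sum_le)
  ultimately show bound: "(\<Sum>z\<in>S. (int (card (N z \<inter> A)))\<^sup>2) \<le> moment_bound k lam mu a d"
    using split[of "\<lambda>n. (int n)\<^sup>2"] by (simp add: moment_bound_def)
  show "min_square_sum (int k * a - d) s \<le> moment_bound k lam mu a d"
    using min_square_sum_le[of "\<lambda>z. int (card (N z \<inter> A))" S] bound unfolding sum_S s_def by simp
qed

end

section \<open>Excluding small separators\<close>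

text \<open>
  \<open>D\<close> is the discriminant of the quadratic equation for the restricted eigenvalues \<open>\<theta>\<close> and \<open>\<tau>\<close>, and \<open>n\<close> is
  the multiplicity of \<open>\<theta>\<close>. Squaring the trace equation \<open>k + n \<theta> + (v - 1 - n) \<tau> = 0\<close> removes the root of \<open>D\<close>.
\<close>

definition trace_integral :: "int \<Rightarrow> int \<Rightarrow> int \<Rightarrow> int \<Rightarrow> bool" where
  "trace_integral v k lam mu \<longleftrightarrow>
    (let D = (lam - mu)^2 + 4 * (k - mu); t = (2 * k + (v - 1) * (lam - mu))^2 in
      list_ex (\<lambda>n. D * (v - 1 - 2 * n)^2 = t) [0..v])"

text \<open>The values of \<open>d\<close> that \<open>part_bounds\<close> allows for one side;
  discarding the others early shortens the search over pairs.\<close>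

definition degree_sums :: "int \<Rightarrow> int \<Rightarrow> int \<Rightarrow> int \<Rightarrow> int \<Rightarrow> int list" where
  "degree_sums k lam mu s a =
    filter (\<lambda>d. min_square_sum (k * a - d) s \<le> moment_bound k lam mu a d) [a + 1..a * (a - 1)]"

text \<open>
  Necessary condition for parts of sizes \<open>a\<close> and \<open>b\<close> with a separator of size \<open>s\<close>: Cauchy--Schwarz for the
  centred neighbour counts of the separator vertices in the two parts, whose inner product before
  centring is \<open>mu * a * b\<close>.
\<close>

definition separation_feasible :: "int \<Rightarrow> int \<Rightarrow> int \<Rightarrow> int \<Rightarrow> int \<Rightarrow> int \<Rightarrow> bool" where
  "separation_feasible k lam mu s a b \<longleftrightarrow>
    list_ex (\<lambda>d. list_ex (\<lambda>d'.
        (s * (mu * a * b) - (k * a - d) * (k * b - d'))^2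
          \<le> (s * moment_bound k lam mu a d - (k * a - d)^2) * (s * moment_bound k lam mu b d' - (k * b - d')^2))
      (degree_sums k lam mu s b)) (degree_sums k lam mu s a)"

text \<open>\<open>parameter_equation\<close> determines \<open>lam\<close> from \<open>v\<close>,
  \<open>k\<close> and \<open>mu\<close>. The range of \<open>k\<close> stops at
  \<open>v - 2\<close> because some pair of distinct vertices is non-adjacent.\<close>

definition integral_parameters :: "int \<Rightarrow> (int \<times> int \<times> int \<times> int) list" where
  "integral_parameters v = concat (map (\<lambda>k. concat (map (\<lambda>mu.
    if (v - k - 1) * mu mod k = 0 then
      let lam = k - 1 - (v - k - 1) * mu div k in
        if 0 \<le> lam then if trace_integral v k lam mu then [(v, k, lam, mu)] else [] else []
    else []) [1..k])) [1..v - 2])"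

text \<open>\<open>s\<close> ranges over the sizes violating the conjecture, and \<open>a\<close> is
  the size of the smaller part. It is at least 3 because \<open>a + 1 \<le> a * (a - 1)\<close>, and
  at least \<open>2 * k - lam - s\<close> because the part and the separator contain the
  neighbourhood of an edge.\<close>

definition small_separation_feasible :: "int \<times> int \<times> int \<times> int \<Rightarrow> bool" where
  "small_separation_feasible = (\<lambda>(v, k, lam, mu).
    list_ex (\<lambda>s. list_ex (\<lambda>a. separation_feasible k lam mu s a (v - s - a))
      [max 3 (2 * k - lam - s)..(v - s) div 2]) [1..2 * k - lam - 3])"

text \<open>The search runs over numerical parameters and not over graphs, so no classification of
  strongly regular graphs enters.\<close>

lemma feasible_parameters:
  "filter small_separation_feasible (concat (map integral_parameters [2..30]))
    = [(15, 8, 4, 4), (21, 10, 5, 4), (28, 12, 6, 4)]"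
  by code_simp

section \<open>Eigenvalue multiplicities and soundness of the search\<close>

context strongly_regular
begin

text \<open>The projection onto the eigenspace of \<theta> is a combination of the adjacency,
  identity and all-ones matrices. Being idempotent it has a natural number as trace, and this is
  \<open>n\<close>.\<close>

lemma multiplicity_equation:
  assumes "0 < v"
  defines "D \<equiv> (int lam - int mu)\<^sup>2 + 4 * (int k - int mu)"
  assumes "0 < D"
  shows "\<exists>n \<le> v. D * (int v - 1 - 2 * int n)\<^sup>2 = (2 * int k + (int v - 1) * (int lam - int mu))\<^sup>2"
proof -
  \<comment> \<open>\<open>rt\<close> is the difference of the restricted eigenvalues,
    \<open>tau\<close> the smaller one, and \<open>c\<close> is chosen so that \<open>e\<close>
    annihilates the all-ones vector.\<close>
  define rt where "rt = sqrt (real_of_int D)"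
  define tau where "tau = (real lam - real mu - rt) / 2"
  define c where "c = (real k - tau) / real v"
  define e where "e x y = (of_bool (y \<in> N x) - tau * of_bool (y = x) - c) / rt" for x y
  have rt_e: "rt * e x y = of_bool (y \<in> N x) - tau * of_bool (y = x) - c" for x y
    using \<open>0 < D\<close> by (simp add: e_def rt_def)
  have D_real: "real_of_int D = (real lam - real mu)\<^sup>2 + 4 * (real k - real mu)"
    by (simp add: D_def)
  have rt: "0 < rt" "rt\<^sup>2 = (real lam - real mu)\<^sup>2 + 4 * (real k - real mu)"
    using D_real \<open>0 < D\<close> by (simp_all add: rt_def)
  have rt_tau: "rt = real lam - real mu - 2 * tau"
    by (simp add: tau_def field_simps)
  have tau_sq: "tau * tau = (real lam - real mu) * tau + real k - real mu"
    using rt(2) unfolding rt_tau by (simp add: power2_eq_square algebra_simps)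
  have cv: "c * real v = real k - tau"
    using \<open>0 < v\<close> by (simp add: c_def)
  \<comment> \<open>In terms of eigenvalues the parameter equation reads
    \<open>mu * v = (k - tau) * (k - theta)\<close> with \<open>theta = tau + rt\<close>.\<close>
  have "real_of_int (int k * (int k - 1 - int lam)) = real_of_int ((int v - int k - 1) * int mu)"
    using parameter_equation[OF \<open>0 < v\<close>] by simp
  then have "real mu * real v = (real k - tau) * (real k - tau - rt)"
    using tau_sq unfolding rt_tau by (simp add: algebra_simps)
  then have "real v * real mu = real v * (c * (real k - tau - rt))"
    unfolding cv[symmetric] by (simp add: algebra_simps)
  then have mu: "real mu = c * (real k - tau - rt)"
    using \<open>0 < v\<close> by simp
  have "(\<Sum>z\<in>V. e x z * e z y) = e x y" if xy: "x \<in> V" "y \<in> V" for x y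
  proof -
    have adj_adj: "(\<Sum>z\<in>V. of_bool (z \<in> N x) * of_bool (y \<in> N z)) = real (card (N x \<inter> N y))"
    proof -
      have "V \<inter> {z. z \<in> N x \<and> y \<in> N z} = N x \<inter> N y"
        using N_subset N_sym by auto
      then show ?thesis
        using pair_finite_verts by (simp flip: of_bool_conj)
    qed
    have deg: "(\<Sum>z\<in>V. of_bool (z \<in> N x)) = real k" "(\<Sum>z\<in>V. of_bool (y \<in> N z)) = real k"
    proof -
      have "V \<inter> {z. z \<in> N u} = N u" for u
        using N_subset by auto
      then show "(\<Sum>z\<in>V. of_bool (z \<in> N x)) = real k" "(\<Sum>z\<in>V. of_bool (y \<in> N z)) = real k"
        using pair_finite_verts card_N xy by (simp_all add: N_sym[of y])
    qed
    have delta: "(\<Sum>z\<in>V. of_bool (z = x) * h z) = h x" "(\<Sum>z\<in>V. of_bool (y = z) * h z) = h y"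
      for h :: "'a \<Rightarrow> real"
      using pair_finite_verts xy by (simp_all add: of_bool_def if_distrib if_distribR cong: if_cong)
    have "rt * rt * (\<Sum>z\<in>V. e x z * e z y) = (\<Sum>z\<in>V. (rt * e x z) * (rt * e z y))"
      by (simp add: sum_distrib_left algebra_simps)
    also have "\<dots> = (\<Sum>z\<in>V. of_bool (z \<in> N x) * of_bool (y \<in> N z)
        - tau * (of_bool (z = x) * of_bool (y \<in> N z)) - tau * (of_bool (y = z) * of_bool (z \<in> N x))
        + tau * tau * (of_bool (z = x) * of_bool (y = z)) + tau * c * (of_bool (z = x) * 1)
        + tau * c * (of_bool (y = z) * 1) - c * of_bool (z \<in> N x) - c * of_bool (y \<in> N z) + c * c)"
      by (intro sum.cong) (simp_all add: rt_e algebra_simps)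
    also have "\<dots> = real (card (N x \<inter> N y)) - 2 * tau * of_bool (y \<in> N x) + tau * tau * of_bool (y = x)
        + 2 * tau * c - 2 * c * real k + c * (c * real v)"
      unfolding sum.distrib sum_subtractf sum_distrib_left[symmetric] adj_adj deg delta
      by (simp add: card_V)
    also have "\<dots> = rt * (of_bool (y \<in> N x) - tau * of_bool (y = x) - c)"
    proof -
      have f: "real mu = c * real k - c * tau - c * rt" "real k = real mu - tau * tau - rt * tau"
        "real lam = rt + 2 * tau + real mu"
        using mu tau_sq unfolding rt_tau by (simp_all add: algebra_simps)
      \<comment> \<open>The three kinds of entries of the squared adjacency matrix: diagonal,
        adjacent, non-adjacent.\<close>
      consider "y = x" | "y \<noteq> x" "y \<in> N x" | "y \<noteq> x" "y \<notin> N x"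
        by blast
      then show ?thesis
      proof cases
        case 1
        then show ?thesis
          unfolding cv card_common_neighbors[OF xy] using N_irrefl[of x] by (simp add: algebra_simps) (use f in linarith)
      next
        case 2
        then show ?thesis
          unfolding cv card_common_neighbors[OF xy] by (simp add: algebra_simps) (use f in linarith)
      next
        case 3
        then show ?thesis
          unfolding cv card_common_neighbors[OF xy] by (simp add: algebra_simps) (use f in linarith)
      qed
    qed
    also have "\<dots> = rt * rt * e x y"
      using rt(1) by (simp add: e_def)
    finally show ?thesis
      using rt(1) by simp
  qed
  then obtain n where n: "n \<le> card V" "(\<Sum>x\<in>V. e x x) = real n"
    using idempotent_kernel_trace[OF pair_finite_verts] by blast
  have "rt * real n = (\<Sum>x\<in>V. rt * e x x)"
    using n(2) by (simp flip: sum_distrib_left)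
  also have "\<dots> = (\<Sum>x\<in>V. - tau - c)"
    using rt(1) N_irrefl by (intro sum.cong) (simp_all add: e_def)
  also have "\<dots> = - (real v - 1) * tau - real k"
    using cv by (simp add: card_V algebra_simps)
  finally have "rt * (real v - 1 - 2 * real n) = 2 * real k + (real v - 1) * (real lam - real mu)"
    unfolding rt_tau by (simp add: algebra_simps)
  then have "rt\<^sup>2 * (real v - 1 - 2 * real n)\<^sup>2 = (2 * real k + (real v - 1) * (real lam - real mu))\<^sup>2"
    by (simp flip: power_mult_distrib)
  also have "rt\<^sup>2 = real_of_int D"
    using \<open>0 < D\<close> by (simp add: rt_def)
  finally have "real_of_int (D * (int v - 1 - 2 * int n)\<^sup>2)
      = real_of_int ((2 * int k + (int v - 1) * (int lam - int mu))\<^sup>2)"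
    by simp
  then show ?thesis
    using n(1) card_V by (metis of_int_eq_iff)
qed

text \<open>If \<open>mu = 0\<close>, a vertex at distance 2 from \<open>x\<close> would share a
  neighbour with \<open>x\<close>, so \<open>insert x (N x)\<close> is closed under adjacency and
  must be all of \<open>V\<close>.\<close>

lemma mu_pos_if_connected:
  assumes conn: "connected (with_proj G)" and xy: "x \<in> V" "y \<in> V" "x \<noteq> y" "y \<notin> N x"
  shows "0 < mu"
proof (rule ccontr)
  assume "\<not> 0 < mu"
  have trans: "w \<in> insert x (N x)" if u: "u \<in> insert x (N x)" "w \<in> N u" for u w
  proof (rule ccontr)
    assume w: "w \<notin> insert x (N x)"
    then have "u \<in> N x \<inter> N w"
      using u N_sym by auto
    moreover have "w \<in> V"
      using u(2) N_subset by blast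
    then have "card (N x \<inter> N w) = 0"
      using card_common_neighbors[of x w] w xy(1) \<open>\<not> 0 < mu\<close> by (cases "x = w") simp_all
    ultimately show False
      by (simp add: card_eq_0_iff) blast
  qed
  have "insert x (N x) = V"
  proof -
    have "\<forall>(u, w) \<in> parcs G. u \<in> insert x (N x) \<longleftrightarrow> w \<in> insert x (N x)"
      using trans N_sym mem_N by blast
    moreover have "insert x (N x) \<subseteq> V"
      using N_subset xy(1) by auto
    ultimately show ?thesis
      using conn unfolding connected_iff_cut[OF wf_digraph_axioms] with_proj_simps by blast
  qed
  then have "y \<in> insert x (N x)"
    using xy(2) by simp
  with xy show False
    by simp
qed

lemma mem_integral_parameters:
  assumes xy: "x \<in> V" "y \<in> V" "x \<noteq> y" "y \<notin> N x" and "0 < mu" and "0 < k"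
  shows "(int v, int k, int lam, int mu) \<in> set (integral_parameters (int v))"
proof -
  have "N x \<subseteq> V - {x, y}"
    using N_subset N_irrefl xy by auto
  then have "card (N x) \<le> card (V - {x, y})"
    using pair_finite_verts by (simp add: card_mono)
  moreover have "card {x, y} \<le> card V"
    using xy pair_finite_verts by (intro card_mono) auto
  ultimately have kv: "k + 2 \<le> v"
    using xy by (simp add: card_N card_V card_Diff_subset)
  then have "0 < v"
    by simp
  note eq = parameter_equation[OF this]
  \<comment> \<open>Positivity of one side of the parameter equation forces
    \<open>lam < k - 1\<close> on the other.\<close>
  have "0 < (int v - int k - 1) * int mu"
    using kv \<open>0 < mu\<close> by simp
  then have lam: "lam + 1 < k"
    using \<open>0 < k\<close> unfolding eq[symmetric] zero_less_mult_iff by linarith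
  have mu: "mu \<le> k"
    using card_common_neighbors[OF xy(1,2)] xy card_N[OF xy(1)] card_mono[of "N x" "N x \<inter> N y"] by simp
  \<comment> \<open>For \<open>mu = k\<close> the linear term vanishes, but then
    \<open>lam < mu\<close> makes the square positive.\<close>
  have "0 < (int lam - int mu)\<^sup>2 + 4 * (int k - int mu)"
  proof (cases "mu = k")
    case True
    then show ?thesis using lam by simp
  next
    case False
    then show ?thesis using mu by (simp add: add_nonneg_pos)
  qed
  from multiplicity_equation[OF \<open>0 < v\<close> this] obtain n where "n \<le> v"
      "((int lam - int mu)\<^sup>2 + 4 * (int k - int mu)) * (int v - 1 - 2 * int n)\<^sup>2
        = (2 * int k + (int v - 1) * (int lam - int mu))\<^sup>2"
    by blast
  then have "trace_integral (int v) (int k) (int lam) (int mu)"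
    unfolding trace_integral_def Let_def list_ex_iff by (intro bexI[of _ "int n"]) auto
  moreover have "(int v - int k - 1) * int mu mod int k = 0"
    "int k - 1 - (int v - int k - 1) * int mu div int k = int lam"
    using \<open>0 < k\<close> by (simp_all flip: eq)
  moreover have "int k \<in> set [1..int v - 2]" "int mu \<in> set [1..int k]"
    using kv mu \<open>0 < mu\<close> \<open>0 < k\<close> by auto
  ultimately show ?thesis
    unfolding integral_parameters_def set_concat set_map UN_iff bex_simps(7)
    by (intro bexI[of _ "int k"] bexI[of _ "int mu"]) (simp_all add: Let_def)
qed

text \<open>Soundness of the search: a small separation supplies witnesses \<open>s\<close>,
  \<open>a\<close>, \<open>d\<close>, \<open>d'\<close> for it. Ordering the two sides by size
  matches the range of \<open>a\<close>.\<close>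

lemma small_separation_parameters:
  assumes un: "A \<union> B \<union> S = V" and disj: "A \<inter> B = {}" "A \<inter> S = {}" "B \<inter> S = {}"
    and ne: "A \<noteq> {}" "B \<noteq> {}"
    and sepA: "\<forall>x \<in> A. N x \<subseteq> A \<union> S" and sepB: "\<forall>x \<in> B. N x \<subseteq> B \<union> S"
    and nbrA: "\<forall>x \<in> A. N x \<inter> A \<noteq> {}" and nbrB: "\<forall>x \<in> B. N x \<inter> B \<noteq> {}"
    and "0 < mu" and "v \<le> 30" and small: "int (card S) < 2 * int k - int lam - 2"
    and le: "card A \<le> card B"
  shows "(v, k, lam, mu) \<in> {(15, 8, 4, 4), (21, 10, 5, 4), (28, 12, 6, 4)}"
proof -
  define a b s where "a = int (card A)" and "b = int (card B)" and "s = int (card S)"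
  define d d' where "d = (\<Sum>x\<in>A. int (card (N x \<inter> A)))" and "d' = (\<Sum>x\<in>B. int (card (N x \<inter> B)))"
  have sub: "A \<subseteq> V" "B \<subseteq> V" "S \<subseteq> V"
    using un by auto
  then have fin: "finite A" "finite B" "finite S"
    using pair_finite_verts finite_subset by blast+
  note A = part_bounds[OF sub(1,3) disj(2) ne(1) sepA nbrA small, folded a_def s_def d_def]
  note B = part_bounds[OF sub(2,3) disj(3) ne(2) sepB nbrB small, folded b_def s_def d'_def]
  have v: "int v = a + b + s"
    using card_V fin disj un[symmetric]
    by (simp add: a_def b_def s_def card_Un_disjoint Int_Un_distrib2)
  obtain x y where xy: "x \<in> A" "y \<in> B"
    using ne by blast
  have nonadjacent: "x \<noteq> y \<and> y \<notin> N x" if "x \<in> A" "y \<in> B" for x y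
  proof -
    have "y \<notin> A \<union> S"
      using that disj by blast
    then show ?thesis
      using that sepA by blast
  qed
  have nonadj: "x \<in> V" "y \<in> V" "x \<noteq> y" "y \<notin> N x"
    using sub xy nonadjacent[OF xy] by auto
  have "N x \<inter> N y \<subseteq> S"
    using sepA sepB xy disj by blast
  moreover have "N x \<inter> N y \<noteq> {}"
    using card_common_neighbors[OF nonadj(1,2)] nonadj \<open>0 < mu\<close> by auto
  ultimately have "S \<noteq> {}"
    by blast
  then have s: "1 \<le> s"
    using fin(3) by (simp add: s_def Suc_leI card_gt_0_iff)
  have "0 < k"
    using nbrA xy(1) card_N[OF nonadj(1)] finite_N[of x] by (cases "N x = {}") (auto simp: card_gt_0_iff)
  \<comment> \<open>Outside \<open>S\<close> one of the two counts is 0, and every pair from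
    \<open>A\<close> and \<open>B\<close> is non-adjacent, hence has \<open>mu\<close> common
    neighbours.\<close>
  have cross: "(\<Sum>z\<in>S. int (card (N z \<inter> A)) * int (card (N z \<inter> B))) = int mu * a * b"
  proof -
    have "(\<Sum>z\<in>S. int (card (N z \<inter> A)) * int (card (N z \<inter> B)))
        = (\<Sum>z\<in>V. int (card (N z \<inter> A)) * int (card (N z \<inter> B)))"
    proof (rule sum.mono_neutral_left)
      show "\<forall>z \<in> V - S. int (card (N z \<inter> A)) * int (card (N z \<inter> B)) = 0"
      proof
        fix z assume "z \<in> V - S"
        then have "N z \<inter> B = {} \<or> N z \<inter> A = {}"
          using un sepA sepB disj by blast
        then show "int (card (N z \<inter> A)) * int (card (N z \<inter> B)) = 0"
          by auto
      qed
    qed (use sub pair_finite_verts in auto)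
    also have "\<dots> = (\<Sum>x\<in>A. \<Sum>y\<in>B. int (card (N x \<inter> N y)))"
      by (rule sum_neighbor_count_products[OF sub(1,2)])
    also have "\<dots> = (\<Sum>x\<in>A. \<Sum>y\<in>B. int mu)"
    proof (intro sum.cong refl)
      fix x y assume "x \<in> A" "y \<in> B"
      then have "x \<in> V" "y \<in> V" "x \<noteq> y" "y \<notin> N x"
        using sub nonadjacent by blast+
      then show "int (card (N x \<inter> N y)) = int mu"
        by (simp add: card_common_neighbors)
    qed
    finally show ?thesis
      by (simp add: a_def b_def)
  qed
  have "d \<in> set (degree_sums k lam mu s a)" "d' \<in> set (degree_sums k lam mu s b)"
    using A(1,2,6) B(1,2,6) by (auto simp: degree_sums_def)
  moreover have "(s * (int mu * a * b) - (int k * a - d) * (int k * b - d'))\<^sup>2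
      \<le> (s * moment_bound k lam mu a d - (int k * a - d)\<^sup>2) * (s * moment_bound k lam mu b d' - (int k * b - d')\<^sup>2)"
    using covariance_square_le[OF fin(3) A(5) B(5)] unfolding A(4) B(4) cross s_def .
  ultimately have "separation_feasible k lam mu s a b"
    unfolding separation_feasible_def list_ex_iff by blast
  \<comment> \<open>The bounds \<open>a + 1 \<le> d\<close> and \<open>d \<le> a * (a - 1)\<close>
    are incompatible for \<open>a = 1\<close> and \<open>a = 2\<close>.\<close>
  moreover have "3 \<le> a"
  proof (rule ccontr)
    assume "\<not> 3 \<le> a"
    moreover have "1 \<le> a"
      using fin(1) ne(1) by (simp add: a_def Suc_leI card_gt_0_iff)
    ultimately have "a = 1 \<or> a = 2"
      by linarith
    then show False
      using A(1,2) by auto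
  qed
  moreover have "a \<le> b"
    using le by (simp add: a_def b_def)
  moreover have "b = int v - s - a"
    using v by simp
  ultimately have "small_separation_feasible (int v, int k, int lam, int mu)"
    using A(3) s small unfolding small_separation_feasible_def prod.case list_ex_iff
    by (intro bexI[of _ s] bexI[of _ a]) (auto simp: s_def)
  moreover have "(int v, int k, int lam, int mu) \<in> set (integral_parameters (int v))"
    using nonadj \<open>0 < mu\<close> \<open>0 < k\<close> by (rule mem_integral_parameters)
  moreover have "int v \<in> set [2..30]"
    unfolding set_upto using v s \<open>v \<le> 30\<close> \<open>3 \<le> a\<close> \<open>a \<le> b\<close> by simp
  ultimately have "(int v, int k, int lam, int mu)
      \<in> set (filter small_separation_feasible (concat (map integral_parameters [2..30])))"
    unfolding set_filter set_concat set_map by blast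
  then show ?thesis
    unfolding feasible_parameters by auto
qed

text \<open>A cut of the remaining graph yields the two sides, each possibly a union of several
  components. The condition on components enters as the absence of isolated vertices.\<close>

lemma Brouwer_bound:
  assumes disc: "disconnecting_set G S"
    and comps: "\<forall>C \<in> components (delete_verts G S). card (verts C) \<ge> 2"
    and "v \<le> 30" and "(v, k, lam, mu) \<notin> {(15, 8, 4, 4), (21, 10, 5, 4), (28, 12, 6, 4)}"
  shows "2 * int k - int lam - 2 \<le> int (card S)"
proof (rule ccontr)
  assume small: "\<not> ?thesis"
  have disc': "connected (with_proj G)" "S \<subseteq> V" "V - S \<noteq> {}" "\<not> connected (delete_verts G S)"
    using disc by (auto simp: disconnecting_set_def)
  then obtain A where A: "A \<subseteq> V - S" "A \<noteq> {}" "A \<noteq> V - S"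
      "\<forall>(x, y) \<in> arcs_ends (delete_verts G S). x \<in> A \<longleftrightarrow> y \<in> A"
    unfolding connected_iff_cut[OF wf_delete_verts] delete_verts_simps(1) by blast
  have closed: "x \<in> A \<longleftrightarrow> y \<in> A" if "x \<in> V - S" "y \<in> V - S" "y \<in> N x" for x y
    using A(4) that unfolding delete_verts_simps mem_N by blast
  define B where "B = V - S - A"
  have nbr: "\<exists>y \<in> V - S. y \<in> N x" if "x \<in> V - S" for x
    using no_isolated_vertex_if_components[OF comps _ that] pair_sym_arcs
    by (auto simp: mem_N symmetric_def)
  have side: "N x \<subseteq> X \<union> S \<and> N x \<inter> X \<noteq> {}"
    if X: "X \<subseteq> V - S" "\<And>u w. u \<in> X \<Longrightarrow> w \<in> V - S \<Longrightarrow> w \<in> N u \<Longrightarrow> w \<in> X" and x: "x \<in> X" for X x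
  proof
    show "N x \<subseteq> X \<union> S"
    proof
      fix w assume "w \<in> N x"
      then show "w \<in> X \<union> S"
        using X(2)[OF x, of w] N_subset[of x] by blast
    qed
    obtain y where "y \<in> V - S" "y \<in> N x"
      using nbr[of x] X(1) x by blast
    then show "N x \<inter> X \<noteq> {}"
      using X(2)[OF x, of y] by blast
  qed
  have "N x \<subseteq> A \<union> S \<and> N x \<inter> A \<noteq> {}" if "x \<in> A" for x
  proof (rule side[OF A(1) _ that])
    show "w \<in> A" if "u \<in> A" "w \<in> V - S" "w \<in> N u" for u w
      using closed[of u w] that A(1) by blast
  qed
  then have A': "\<forall>x \<in> A. N x \<subseteq> A \<union> S" "\<forall>x \<in> A. N x \<inter> A \<noteq> {}"
    by simp_all
  have "N x \<subseteq> B \<union> S \<and> N x \<inter> B \<noteq> {}" if "x \<in> B" for x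
  proof (rule side[OF _ _ that])
    show "w \<in> B" if "u \<in> B" "w \<in> V - S" "w \<in> N u" for u w
      using closed[of u w] that by (simp add: B_def)
  qed (simp add: B_def)
  then have B': "\<forall>x \<in> B. N x \<subseteq> B \<union> S" "\<forall>x \<in> B. N x \<inter> B \<noteq> {}"
    by simp_all
  have part: "A \<union> B \<union> S = V" "A \<inter> B = {}" "A \<inter> S = {}" "B \<inter> S = {}" "B \<noteq> {}"
    using A(1,3) disc'(2) by (auto simp: B_def)
  obtain x y where xy: "x \<in> A" "y \<in> B"
    using A(2) part(5) by blast
  have "y \<notin> A \<union> S"
    using xy part by blast
  then have "x \<noteq> y" "y \<notin> N x"
    using A'(1) xy by blast+
  moreover have "x \<in> V" "y \<in> V"
    using part(1) xy by blast+
  ultimately have "0 < mu"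
    using mu_pos_if_connected[OF disc'(1)] by blast
  note separation = small_separation_parameters[OF _ _ _ _ _ _ _ _ _ _ \<open>0 < mu\<close> \<open>v \<le> 30\<close>]
  have small': "int (card S) < 2 * int k - int lam - 2"
    using small by simp
  show False
  proof (cases "card A \<le> card B")
    case True
    then show False
      using separation[OF part(1-4) A(2) part(5) A'(1) B'(1) A'(2) B'(2) small'] assms(4) by blast
  next
    case False
    then have "card B \<le> card A"
      by simp
    moreover have "B \<union> A \<union> S = V" "B \<inter> A = {}"
      using part(1,2) by blast+
    ultimately show False
      using separation[OF _ _ part(4,3,5) A(2) B'(1) A'(1) B'(2) A'(2) small'] assms(4) by blast
  qed
qed

end

theorem mainTheorem18:
  fixes v k lam mu :: nat
  assumes "\<exists>G\<^sub>0 :: nat pair_pre_digraph. primitive_srg v k lam mu G\<^sub>0"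
    and "v \<le> 30"
  shows "((v, k, lam, mu) \<notin> {(15, 8, 4, 4), (21, 10, 5, 4), (28, 12, 6, 4)} \<longrightarrow>
           (\<forall>G :: 'a pair_pre_digraph. primitive_srg v k lam mu G \<longrightarrow>
             (\<forall>S. disconnecting_set G S \<and>
                  (\<forall>C \<in> components (delete_verts G S). card (verts C) \<ge> 2) \<longrightarrow>
                  int (card S) \<ge> 2 * int k - int lam - 2)))
       \<and> ((v, k, lam, mu) \<in> {(15, 8, 4, 4), (21, 10, 5, 4), (28, 12, 6, 4)} \<longrightarrow>
           (\<exists>G :: nat pair_pre_digraph. srg v k lam mu G \<and>
             (\<exists>S. disconnecting_set G S \<and>
                  (\<forall>C \<in> components (delete_verts G S). card (verts C) \<ge> 2) \<and>
                  int (card S) < 2 * int k - int lam - 2)))"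
proof (intro conjI impI allI)
  fix G :: "'a pair_pre_digraph" and S
  assume quad: "(v, k, lam, mu) \<notin> {(15, 8, 4, 4), (21, 10, 5, 4), (28, 12, 6, 4)}"
    and prim: "primitive_srg v k lam mu G"
    and S: "disconnecting_set G S \<and> (\<forall>C \<in> components (delete_verts G S). card (verts C) \<ge> 2)"
  have srg: "srg v k lam mu G"
    using prim by (simp add: primitive_srg_def)
  then have "pair_graph G"
    by (simp add: srg_def)
  then have "strongly_regular G v k lam mu"
    using srg by (simp add: strongly_regular_def strongly_regular_axioms_def)
  then show "2 * int k - int lam - 2 \<le> int (card S)"
    using strongly_regular.Brouwer_bound[of G v k lam mu S] S quad \<open>v \<le> 30\<close> by blast
next
  assume "(v, k, lam, mu) \<in> {(15, 8, 4, 4), (21, 10, 5, 4), (28, 12, 6, 4)}"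
  then consider "v = 15" "k = 8" "lam = 4" "mu = 4" | "v = 21" "k = 10" "lam = 5" "mu = 4"
    | "v = 28" "k = 12" "lam = 6" "mu = 4"
    by auto
  then show "\<exists>G :: nat pair_pre_digraph. srg v k lam mu G \<and>
      (\<exists>S. disconnecting_set G S \<and> (\<forall>C \<in> components (delete_verts G S). card (verts C) \<ge> 2) \<and>
        int (card S) < 2 * int k - int lam - 2)"
  \<comment> \<open>The remaining comparisons of separator size and bound are 9 < 10, 12 < 13 and 15
    < 16.\<close>
  proof cases
    case 1
    show ?thesis
      unfolding 1 by (rule triangular_counterexample[OF triangular_check_6]) simp_all
  next
    case 2
    show ?thesis
      unfolding 2 by (rule triangular_counterexample[OF triangular_check_7]) simp_all
  next
    case 3
    show ?thesis
      unfolding 3 by (rule triangular_counterexample[OF triangular_check_8]) simp_all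
  qed
qed

end
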